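(* Let $\mathbb G$ be a Carnot group and let $\Omega\subset\mathbb G$ be a bounded domain with compact $C^1$ boundary and no characteristic points. Then $\Omega$ satisfies the intrinsic exterior cone condition.
   Context: Carnot groups. A Carnot group $\mathbb G$ of step $k$ is a connected, simply connected Lie group whose Lie algebra is stratified: $\mathfrak g=V_1\oplus\cdots\oplus V_k$ with $V_i\ne\{0\}$, $[V_1,V_{i-1}]=V_i$ for $2\le i\le k$, and $[V_1,V_k]=\{0\}$; $\dim\mathfrak g\ge3$. Via the exponential map $\mathbb G$ is identified with a homogeneous Carnot group on $\mathbb R^n=\mathbb R^{m_1}\times\cdots\times\mathbb R^{m_k}$, $m_i=\dim V_i$, with identity $e=0$, $x^{-1}=-x$, and dilations $\delta_\lambda(\xi_1,\dots,\xi_k)=(\lambda\xi_1,\dots,\lambda^k\xi_k)$, $\lambda>0$. $V_1$ carries a fixed inner product $\langle\cdot,\cdot\rangle_{\mathcal H}$. A homogeneous norm is a continuous $\|\cdot\|:\mathbb G\to[0,\infty)$ with $\|\delta_\lambda x\|=\lambda\|x\|$, $\|x\|>0$ iff $x\ne0$, $\|xy\|\le\|x\|+\|y\|$; one is fixed. $C^1$ boundary means that near each $p_0\in\partial\Omega$ there are a neighborhood $U$ and $\Phi\in C^1(U)$ with nonvanishing differential such that $\Omega\cap U=\{\Phi<0\}$, $\partial\Omega\cap U=\{\Phi=0\}$, $U\setminus\overline\Omega=\{\Phi>0\}$. A point $p\in\partial\Omega$ is characteristic if $\mathcal H_p\subseteq T_p(\partial\Omega)$, where $\mathcal H_p\subset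 T_p\mathbb G$ is the left translate to $p$ of $V_1\subset T_e\mathbb G$. Intrinsic exterior cone condition. For $X\in V_1$ with $\langle X,X\rangle_{\mathcal H}=1$, let $W_X=\{Y\in V_1:\langle X,Y\rangle_{\mathcal H}=0\}$, $\mathbb H_X=\exp(W_X\oplus V_2\oplus\cdots\oplus V_k)$, $\mathbb K_X^+=\{\exp(tX):t\ge0\}$. For $p\in\mathbb G$, $\beta,\rho>0$ put $\mathcal C_p^+(\beta,\rho;X)=p\{hk: h\in\mathbb H_X,\ k\in\mathbb K_X^+,\ \|h\|\le\beta\|k\|,\ \|k\|<\rho\}$. An open set $\Omega$ satisfies the intrinsic exterior cone condition if there exist $\beta,\rho>0$ such that for every $p\in\partial\Omega$ there is a unit vector $X_p\in V_1$ with $\mathcal C_p^+(\beta,\rho;X_p)\setminus\{p\}\subseteq\mathbb G\setminus\overline\Omega$. *)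

theory Defs
  imports "HOL-Analysis.Analysis"
begin

section \<open>Maps of class C^k on open sets\<close>

text \<open>Partial derivatives in all directions are iterated; on an open subset of a Euclidean
  space this is the usual notion of class C^k. It is only used for open sets.\<close>

primrec Ck_on :: "nat \<Rightarrow> ('a::euclidean_space \<Rightarrow> 'b::real_normed_vector) \<Rightarrow> 'a set \<Rightarrow> bool" where
  "Ck_on 0 f S \<longleftrightarrow> continuous_on S f"
| "Ck_on (Suc n) f S \<longleftrightarrow>
     (\<forall>x\<in>S. f differentiable (at x)) \<and>
     (\<forall>v. Ck_on n (\<lambda>x. frechet_derivative f (at x) v) S)"

definition smooth_on :: "('a::euclidean_space \<Rightarrow> 'b::real_normed_vector) \<Rightarrow> 'a set \<Rightarrow> bool" where
  "smooth_on f S \<longleftrightarrow> (\<forall>n. Ck_on n f S)"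


section \<open>Lie group structures on a Euclidean space\<close>

text \<open>All definitions in this section are for a Lie group whose underlying manifold is the whole
  space 'a and whose identity is 0. Every tangent space is identified with 'a.\<close>

text \<open>The left-invariant vector field with value v at the identity, i.e. the differential at the
  identity of left translation by p, applied to v.\<close>

definition left_field :: "('a \<Rightarrow> 'a \<Rightarrow> 'a::euclidean_space) \<Rightarrow> 'a \<Rightarrow> 'a \<Rightarrow> 'a" where
  "left_field mul v p = frechet_derivative (mul p) (at 0) v"

text \<open>The value at the identity of the commutator of the two left-invariant vector fields.\<close>

definition lie_bracket :: "('a \<Rightarrow> 'a \<Rightarrow> 'a::euclidean_space) \<Rightarrow> 'a \<Rightarrow> 'a \<Rightarrow> 'a" where
  "lie_bracket mul v w =
     frechet_derivative (left_field mul w) (at 0) v - frechet_derivative (left_field mul v) (at 0) w"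

text \<open>The time-one value of the one-parameter subgroup with initial velocity v. In a Lie group
  this subgroup exists and is unique, so the description is proper.\<close>

definition lie_exp :: "('a \<Rightarrow> 'a \<Rightarrow> 'a::euclidean_space) \<Rightarrow> 'a \<Rightarrow> 'a" where
  "lie_exp mul v = (THE y. \<exists>\<gamma>::real \<Rightarrow> 'a.
     (\<forall>s t. \<gamma> (s + t) = mul (\<gamma> s) (\<gamma> t)) \<and> (\<gamma> has_vector_derivative v) (at 0) \<and> \<gamma> 1 = y)"


section \<open>Carnot groups\<close>

text \<open>Families c with c i in V i for i = 1, ..., k, set to 0 outside this range so that they
  are determined by their relevant entries.\<close>

definition layer_family :: "(nat \<Rightarrow> 'a::real_vector set) \<Rightarrow> nat \<Rightarrow> (nat \<Rightarrow> 'a) \<Rightarrow> bool" where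
  "layer_family V k c \<longleftrightarrow> (\<forall>i\<in>{1..k}. c i \<in> V i) \<and> (\<forall>i. i \<notin> {1..k} \<longrightarrow> c i = 0)"

definition direct_sum_decomp :: "(nat \<Rightarrow> 'a::real_vector set) \<Rightarrow> nat \<Rightarrow> bool" where
  "direct_sum_decomp V k \<longleftrightarrow>
     (\<forall>i\<in>{1..k}. subspace (V i)) \<and>
     (\<forall>x. \<exists>!c. layer_family V k c \<and> x = (\<Sum>i=1..k. c i))"

definition layer_component :: "(nat \<Rightarrow> 'a::real_vector set) \<Rightarrow> nat \<Rightarrow> 'a \<Rightarrow> nat \<Rightarrow> 'a" where
  "layer_component V k x = (THE c. layer_family V k c \<and> x = (\<Sum>i=1..k. c i))"

definition dilation :: "(nat \<Rightarrow> 'a::real_vector set) \<Rightarrow> nat \<Rightarrow> real \<Rightarrow> 'a \<Rightarrow> 'a" where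
  "dilation V k r x = (\<Sum>i=1..k. r ^ i *\<^sub>R layer_component V k x i)"

text \<open>A Carnot group of step k, identified with its Lie algebra through the exponential map:
  the underlying manifold is a Euclidean space (hence connected and simply connected), the identity
  is 0, inversion is negation, and the exponential map is the identity map. The layers are arbitrary
  complementary subspaces; they need not be orthogonal for the inner product of the type 'a.
  That the dilations are group automorphisms follows from these axioms.\<close>

locale carnot_group = Groups.group mul 0 uminus
  for mul :: "'a::euclidean_space \<Rightarrow> 'a \<Rightarrow> 'a" +
  fixes V :: "nat \<Rightarrow> 'a set" and k :: nat
  assumes smooth_mul: "smooth_on (\<lambda>z. mul (fst z) (snd z)) UNIV"
    and exp_coordinates: "lie_exp mul v = v"
    and step_pos: "1 \<le> k"
    and dim_ge_3: "3 \<le> DIM('a)"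
    and decomp: "direct_sum_decomp V k"
    and layer_nonzero: "i \<in> {1..k} \<Longrightarrow> V i \<noteq> {0}"
    and bracket_layer:
      "i \<in> {2..k} \<Longrightarrow> span {lie_bracket mul x y | x y. x \<in> V 1 \<and> y \<in> V (i - 1)} = V i"
    and bracket_top: "span {lie_bracket mul x y | x y. x \<in> V 1 \<and> y \<in> V k} = {0}"

definition inner_product_on :: "'a::real_vector set \<Rightarrow> ('a \<Rightarrow> 'a \<Rightarrow> real) \<Rightarrow> bool" where
  "inner_product_on S ip \<longleftrightarrow>
     (\<forall>x\<in>S. \<forall>y\<in>S. ip x y = ip y x) \<and>
     (\<forall>x\<in>S. \<forall>y\<in>S. \<forall>z\<in>S. ip (x + y) z = ip x z + ip y z) \<and>
     (\<forall>x\<in>S. \<forall>y\<in>S. \<forall>r. ip (r *\<^sub>R x) y = r * ip x y) \<and>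
     (\<forall>x\<in>S. x \<noteq> 0 \<longrightarrow> 0 < ip x x)"

definition homogeneous_norm ::
    "('a \<Rightarrow> 'a \<Rightarrow> 'a::euclidean_space) \<Rightarrow> (nat \<Rightarrow> 'a set) \<Rightarrow> nat \<Rightarrow> ('a \<Rightarrow> real) \<Rightarrow> bool" where
  "homogeneous_norm mul V k N \<longleftrightarrow>
     continuous_on UNIV N \<and>
     (\<forall>x. 0 \<le> N x) \<and>
     (\<forall>r>0. \<forall>x. N (dilation V k r x) = r * N x) \<and>
     (\<forall>x. 0 < N x \<longleftrightarrow> x \<noteq> 0) \<and>
     (\<forall>x y. N (mul x y) \<le> N x + N y)"


section \<open>C^1 boundaries and characteristic points\<close>

definition C1_boundary :: "'a::euclidean_space set \<Rightarrow> bool" where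
  "C1_boundary \<Omega> \<longleftrightarrow>
     (\<forall>p\<in>frontier \<Omega>. \<exists>U (\<Phi>::'a \<Rightarrow> real).
        open U \<and> p \<in> U \<and> Ck_on 1 \<Phi> U \<and>
        (\<forall>x\<in>U. frechet_derivative \<Phi> (at x) \<noteq> (\<lambda>_. 0)) \<and>
        \<Omega> \<inter> U = {x\<in>U. \<Phi> x < 0} \<and>
        frontier \<Omega> \<inter> U = {x\<in>U. \<Phi> x = 0} \<and>
        U - closure \<Omega> = {x\<in>U. \<Phi> x > 0})"

text \<open>Velocities at p of C^1 curves contained in S. If S is a C^1 submanifold, this is its tangent
  space at p.\<close>

definition tangent_vectors :: "'a::euclidean_space set \<Rightarrow> 'a \<Rightarrow> 'a set" where
  "tangent_vectors S p = {v. \<exists>(\<gamma>::real \<Rightarrow> 'a) e. e > 0 \<and>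
     \<gamma> C1_differentiable_on {-e<..<e} \<and> (\<forall>t\<in>{-e<..<e}. \<gamma> t \<in> S) \<and>
     \<gamma> 0 = p \<and> (\<gamma> has_vector_derivative v) (at 0)}"

definition horizontal_space ::
    "('a \<Rightarrow> 'a \<Rightarrow> 'a::euclidean_space) \<Rightarrow> (nat \<Rightarrow> 'a set) \<Rightarrow> 'a \<Rightarrow> 'a set" where
  "horizontal_space mul V p = (\<lambda>v. left_field mul v p) ` V 1"

definition characteristic_point ::
    "('a \<Rightarrow> 'a \<Rightarrow> 'a::euclidean_space) \<Rightarrow> (nat \<Rightarrow> 'a set) \<Rightarrow> 'a set \<Rightarrow> 'a \<Rightarrow> bool" where
  "characteristic_point mul V \<Omega> p \<longleftrightarrow>
     p \<in> frontier \<Omega> \<and> horizontal_space mul V p \<subseteq> tangent_vectors (frontier \<Omega>) p"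


section \<open>The intrinsic exterior cone condition\<close>

definition H_set ::
    "('a \<Rightarrow> 'a \<Rightarrow> 'a::euclidean_space) \<Rightarrow> (nat \<Rightarrow> 'a set) \<Rightarrow> nat \<Rightarrow> ('a \<Rightarrow> 'a \<Rightarrow> real) \<Rightarrow> 'a \<Rightarrow> 'a set"
  where
  "H_set mul V k ip X = lie_exp mul ` span ({Y\<in>V 1. ip X Y = 0} \<union> (\<Union>i\<in>{2..k}. V i))"

definition K_ray :: "('a \<Rightarrow> 'a \<Rightarrow> 'a::euclidean_space) \<Rightarrow> 'a \<Rightarrow> 'a set" where
  "K_ray mul X = {lie_exp mul (t *\<^sub>R X) | t. 0 \<le> t}"

definition intrinsic_cone ::
    "('a \<Rightarrow> 'a \<Rightarrow> 'a::euclidean_space) \<Rightarrow> (nat \<Rightarrow> 'a set) \<Rightarrow> nat \<Rightarrow> ('a \<Rightarrow> 'a \<Rightarrow> real) \<Rightarrow>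
     ('a \<Rightarrow> real) \<Rightarrow> 'a \<Rightarrow> real \<Rightarrow> real \<Rightarrow> 'a \<Rightarrow> 'a set" where
  "intrinsic_cone mul V k ip N p \<beta> \<rho> X =
     mul p ` {mul h l | h l. h \<in> H_set mul V k ip X \<and> l \<in> K_ray mul X \<and>
                             N h \<le> \<beta> * N l \<and> N l < \<rho>}"

definition intrinsic_exterior_cone_condition ::
    "('a \<Rightarrow> 'a \<Rightarrow> 'a::euclidean_space) \<Rightarrow> (nat \<Rightarrow> 'a set) \<Rightarrow> nat \<Rightarrow> ('a \<Rightarrow> 'a \<Rightarrow> real) \<Rightarrow>
     ('a \<Rightarrow> real) \<Rightarrow> 'a set \<Rightarrow> bool" where
  "intrinsic_exterior_cone_condition mul V k ip N \<Omega> \<longleftrightarrow>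
     (\<exists>\<beta>>0. \<exists>\<rho>>0. \<forall>p\<in>frontier \<Omega>. \<exists>X\<in>V 1. ip X X = 1 \<and>
        intrinsic_cone mul V k ip N p \<beta> \<rho> X - {p} \<subseteq> UNIV - closure \<Omega>)"

end

theory Submission
  imports Defs
begin

text \<open>At a boundary point \<open>p\<^sub>0\<close> that is not characteristic, the kernel of \<open>D\<Phi>\<close> consists of tangent
  vectors, so some unit horizontal \<open>X\<close> satisfies \<open>D\<Phi> (X p\<^sub>0) > 0\<close>. By continuity the derivative of
  \<open>y \<mapsto> \<Phi> (p y)\<close> at \<open>y\<close> in direction \<open>v\<close> is positive for all \<open>(p, y, v)\<close> near \<open>(p\<^sub>0, 0, X)\<close>. A point of a
  narrow short cone at \<open>p\<close> with axis \<open>X\<close> is \<open>p (t v)\<close> with \<open>t\<close> small and \<open>v\<close> close to \<open>X\<close>, so \<open>\<Phi> > 0\<close>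
  there. The same \<open>X\<close>, \<open>\<beta>\<close> and \<open>\<rho>\<close> serve all boundary points near \<open>p\<^sub>0\<close>, and compactness makes \<open>\<beta>\<close>
  and \<open>\<rho>\<close> uniform.\<close>

section \<open>C^1 maps and tangent vectors of a regular level set\<close>

lemma Ck_on_1_has_derivative:
  assumes "Ck_on 1 f S" "x \<in> S"
  shows "(f has_derivative frechet_derivative f (at x)) (at x)"
  using assms by (simp add: frechet_derivative_works)

text \<open>\<open>Ck_on\<close> only provides continuity of \<open>x \<mapsto> Df(x) v\<close> for
  each fixed \<open>v\<close>. Expanding the direction in the finite basis turns the derivative into
  a finite sum of such maps with continuous coefficients, hence continuity jointly in point and
  direction.\<close>

lemma Ck_on_1_continuous_on_derivative:
  fixes f :: "'a::euclidean_space \<Rightarrow> 'b::real_normed_vector"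
  assumes "Ck_on 1 f S"
  shows "continuous_on (S \<times> UNIV) (\<lambda>z. frechet_derivative f (at (fst z)) (snd z))"
proof -
  have cont: "continuous_on S (\<lambda>x. frechet_derivative f (at x) b)" for b
    using assms by simp
  have "continuous_on (S \<times> UNIV)
      (\<lambda>z. \<Sum>b\<in>Basis. (snd z \<bullet> b) *\<^sub>R frechet_derivative f (at (fst z)) b)"
    by (intro continuous_intros continuous_on_compose2 [OF cont]) auto
  moreover have "(\<Sum>b\<in>Basis. (w \<bullet> b) *\<^sub>R frechet_derivative f (at x) b) = frechet_derivative f (at x) w"
    if "x \<in> S" for x w
  proof -
    interpret D: linear "frechet_derivative f (at x)"
      using Ck_on_1_has_derivative [OF assms that] by (rule has_derivative_linear)
    show ?thesis
      by (simp flip: D.scale D.sum add: euclidean_representation)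
  qed
  ultimately show ?thesis
    by (elim continuous_on_eq) auto
qed

text \<open>The map straightening the level set is \<open>x \<mapsto> x + (\<Phi> x - D\<Phi>\<^sub>p (x - p)) u\<close> with
  \<open>D\<Phi>\<^sub>p u = 1\<close>: its derivative at \<open>p\<close> is the identity, and \<open>D\<Phi>\<^sub>p\<close> of the image of \<open>x\<close> minus \<open>p\<close>
  is \<open>\<Phi> x\<close>. The curve is therefore the preimage of a line.\<close>

lemma kernel_subset_tangent_vectors:
  fixes \<Phi> :: "'a::euclidean_space \<Rightarrow> real"
  assumes "open U" "p \<in> U" and C1: "Ck_on 1 \<Phi> U"
    and level: "S \<inter> U = {x\<in>U. \<Phi> x = 0}" and "p \<in> S"
    and nz: "frechet_derivative \<Phi> (at p) \<noteq> (\<lambda>_. 0)"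
    and ker: "frechet_derivative \<Phi> (at p) w = 0"
  shows "w \<in> tangent_vectors S p"
proof -
  define D where "D x = frechet_derivative \<Phi> (at x)" for x
  have der: "(\<Phi> has_derivative D x) (at x)" if "x \<in> U" for x
    using Ck_on_1_has_derivative [OF C1 that] by (simp add: D_def)
  have bl: "bounded_linear (D x)" if "x \<in> U" for x
    using der [OF that] by (rule has_derivative_bounded_linear)
  have contD: "continuous_on U (\<lambda>x. D x v)" for v
    using C1 by (simp add: D_def)
  have kerD: "D p w = 0"
    using ker by (simp add: D_def)
  interpret Dp: bounded_linear "D p" by (rule bl) fact
  obtain u0 where "D p u0 \<noteq> 0"
    using nz by (auto simp: D_def)
  define u where "u = u0 /\<^sub>R D p u0"
  have u: "D p u = 1"
    using \<open>D p u0 \<noteq> 0\<close> by (simp add: u_def Dp.scaleR)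
  define G where "G x = x + (\<Phi> x - D p (x - p)) *\<^sub>R u" for x
  \<comment> \<open>The inverse function theorem asks for a continuous derivative in the space of
    bounded operators. In finite dimension this continuity can be checked on basis vectors, where it
    reduces to \<open>contD\<close>.\<close>
  define G' where "G' x = Blinfun (\<lambda>v. v + (D x v - D p v) *\<^sub>R u)" for x
  have blG: "bounded_linear (\<lambda>v. v + (D x v - D p v) *\<^sub>R u)" if "x \<in> U" for x
    by (intro bounded_linear_intros bounded_linear_compose [OF bounded_linear_scaleR_left]
        bl that \<open>p \<in> U\<close>)
  have G': "blinfun_apply (G' x) v = v + (D x v - D p v) *\<^sub>R u" if "x \<in> U" for x v
    unfolding G'_def using bounded_linear_Blinfun_apply [OF blG [OF that]] by simp
  have derG: "(G has_derivative blinfun_apply (G' x)) (at x)" if "x \<in> U" for x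
    unfolding G_def
    by (rule has_derivative_eq_rhs,
        (rule derivative_intros der [OF that] Dp.has_derivative)+)
       (simp add: fun_eq_iff G' [OF that] Dp.zero)
  have contG': "continuous_on U G'"
  proof (rule continuous_on_blinfun_componentwise)
    fix i :: 'a assume "i \<in> Basis"
    have "continuous_on U (\<lambda>x. i + (D x i - D p i) *\<^sub>R u)"
      by (intro continuous_intros contD)
    then show "continuous_on U (\<lambda>x. blinfun_apply (G' x) i)"
      by (rule continuous_on_eq) (simp add: G')
  qed
  \<comment> \<open>The rank-one term of \<open>G'\<close> vanishes at \<open>p\<close>, so the
    identity is a left inverse there.\<close>
  have inv: "id_blinfun o\<^sub>L G' p = id_blinfun"
    using \<open>p \<in> U\<close> by (intro blinfun_eqI) (simp add: G')
  obtain U' T g g' where U': "U' \<subseteq> U" and T: "open T" "G p \<in> T"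
    and hom: "homeomorphism U' T G g" and "p \<in> U'"
    and derg: "\<And>y. y \<in> T \<Longrightarrow> (g has_derivative g' y) (at y)"
    and g': "\<And>y. y \<in> T \<Longrightarrow> g' y = inv_into UNIV (blinfun_apply (G' (g y)))"
    and bij: "\<And>y. y \<in> T \<Longrightarrow> bij (blinfun_apply (G' (g y)))"
    using inverse_function_theorem [OF \<open>open U\<close> derG contG' \<open>p \<in> U\<close> inv] by metis
  have "\<Phi> p = 0"
    using level \<open>p \<in> U\<close> \<open>p \<in> S\<close> by auto
  then have Gp: "G p = p"
    by (simp add: G_def Dp.zero)
  define line where "line s = p + s *\<^sub>R w" for s :: real
  have "open (line -` T)"
    unfolding line_def using T by (intro open_vimage continuous_intros)
  moreover have "0 \<in> line -` T"
    using T Gp by (simp add: line_def)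
  ultimately obtain e where e: "e > 0" "ball 0 e \<subseteq> line -` T"
    using open_contains_ball by blast
  then have line: "line s \<in> T" if "s \<in> {-e<..<e}" for s
    using that by (auto simp: subset_iff dist_real_def)
  have gU: "g y \<in> U" if "y \<in> T" for y
    using hom U' that by (auto simp: homeomorphism_def)
  define \<gamma> where "\<gamma> s = g (line s)" for s
  \<comment> \<open>This is \<open>G'(\<gamma> s)\<close> inverted on \<open>w\<close>. Since
    \<open>G'\<close> is a rank-one perturbation of the identity along \<open>u\<close>, the
    solution is \<open>w - c u\<close>; \<open>D p w = 0\<close> and \<open>D p u = 1\<close> force
    this \<open>c\<close>. The closed form makes continuity of the velocity visible.\<close>
  define \<gamma>' where "\<gamma>' s = w - (D (\<gamma> s) w / D (\<gamma> s) u) *\<^sub>R u" for s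
  have \<gamma>0: "\<gamma> 0 = p"
    using homeomorphism_apply1 [OF hom \<open>p \<in> U'\<close>] by (simp add: \<gamma>_def line_def Gp)
  \<comment> \<open>If \<open>D (g y) u = 0\<close>, then \<open>G'(g y) u = u - u = 0\<close>,
    against injectivity. So the denominator in \<open>\<gamma>'\<close> never vanishes.\<close>
  have Du: "D (g y) u \<noteq> 0" if "y \<in> T" for y
  proof
    assume "D (g y) u = 0"
    then have "blinfun_apply (G' (g y)) u = blinfun_apply (G' (g y)) 0"
      using gU [OF that] by (simp add: G' u)
    then have "u = 0"
      using bij [OF that] by (metis bij_is_inj injD)
    then show False
      using u by (simp add: Dp.zero)
  qed
  have g'w: "g' y w = w - (D (g y) w / D (g y) u) *\<^sub>R u" (is "_ = ?v") if "y \<in> T" for y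
  proof -
    interpret Dy: bounded_linear "D (g y)"
      by (rule bl) (rule gU [OF that])
    have "blinfun_apply (G' (g y)) ?v = w"
      using Du [OF that] gU [OF that]
      by (simp add: G' Dy.diff Dy.scaleR Dp.diff Dp.scaleR u kerD)
    then show ?thesis
      using g' [OF that] bij [OF that] by (metis bij_is_inj inv_f_f)
  qed
  have der_\<gamma>: "(\<gamma> has_vector_derivative \<gamma>' s) (at s)" if "s \<in> {-e<..<e}" for s
  proof -
    have "(line has_vector_derivative w) (at s)"
      unfolding line_def by (auto intro!: derivative_eq_intros)
    then have "(g \<circ> line has_vector_derivative g' (line s) w) (at s)"
      by (rule vector_derivative_diff_chain_within)
         (rule has_derivative_at_withinI [OF derg [OF line [OF that]]])
    then show ?thesis
      using g'w [OF line [OF that]] by (simp add: \<gamma>_def [abs_def] \<gamma>'_def comp_def)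
  qed
  have cont_\<gamma>: "continuous_on {-e<..<e} \<gamma>"
    using der_\<gamma> by (meson continuous_at_imp_continuous_on has_vector_derivative_continuous)
  have \<gamma>U: "\<gamma> ` {-e<..<e} \<subseteq> U"
    using gU line by (auto simp: \<gamma>_def)
  have "continuous_on {-e<..<e} \<gamma>'"
    unfolding \<gamma>'_def
    by (intro continuous_intros continuous_on_compose2 [OF contD cont_\<gamma> \<gamma>U] ballI)
       (use Du line in \<open>auto simp: \<gamma>_def\<close>)
  then have "\<gamma> C1_differentiable_on {-e<..<e}"
    using der_\<gamma> unfolding C1_differentiable_on_def by blast
  moreover have "\<gamma> s \<in> S" if "s \<in> {-e<..<e}" for s
  proof -
    have "G (\<gamma> s) = line s"
      using homeomorphism_apply2 [OF hom line [OF that]] by (simp add: \<gamma>_def)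
    then have "D p (G (\<gamma> s) - p) = 0"
      using kerD by (simp add: line_def Dp.scaleR)
    then have "\<Phi> (\<gamma> s) = 0"
      by (simp add: G_def Dp.diff Dp.add Dp.scaleR u)
    moreover have "\<gamma> s \<in> U"
      using \<gamma>U that by blast
    ultimately show ?thesis
      using level by blast
  qed
  moreover have "(\<gamma> has_vector_derivative w) (at 0)"
    using der_\<gamma> [of 0] \<open>e > 0\<close> kerD by (simp add: \<gamma>'_def \<gamma>0)
  ultimately show ?thesis
    unfolding tangent_vectors_def using \<open>e > 0\<close> \<gamma>0 by blast
qed


section \<open>Layer components and dilations\<close>

context
  fixes V :: "nat \<Rightarrow> 'a::real_vector set" and k :: nat
  assumes decomp: "direct_sum_decomp V k"
begin

lemma
  shows layer_family_layer_component: "layer_family V k (layer_component V k x)"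
    and sum_layer_component: "(\<Sum>i=1..k. layer_component V k x i) = x"
proof -
  have "\<exists>!c. layer_family V k c \<and> x = (\<Sum>i=1..k. c i)"
    using decomp by (simp add: direct_sum_decomp_def)
  from theI' [OF this] show "layer_family V k (layer_component V k x)"
    and "(\<Sum>i=1..k. layer_component V k x i) = x"
    by (simp_all add: layer_component_def)
qed

lemma layer_component_sum:
  assumes "layer_family V k c"
  shows "layer_component V k (\<Sum>i=1..k. c i) = c"
proof -
  have "\<exists>!c'. layer_family V k c' \<and> (\<Sum>i=1..k. c i) = (\<Sum>i=1..k. c' i)"
    using decomp by (simp add: direct_sum_decomp_def)
  then show ?thesis
    unfolding layer_component_def by (rule the1_equality) (use assms in simp)
qed

lemma subspace_layer: "i \<in> {1..k} \<Longrightarrow> subspace (V i)"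
  using decomp by (simp add: direct_sum_decomp_def)

lemma layer_component_add:
  "layer_component V k (x + y) i = layer_component V k x i + layer_component V k y i"
proof -
  let ?c = "\<lambda>i. layer_component V k x i + layer_component V k y i"
  have "layer_family V k ?c"
    using layer_family_layer_component [of x] layer_family_layer_component [of y] subspace_layer
    by (auto simp: layer_family_def intro: subspace_add)
  from layer_component_sum [OF this] show ?thesis
    by (simp add: sum.distrib sum_layer_component del: One_nat_def)
qed

lemma layer_family_scale:
  "layer_family V k (\<lambda>i. a i *\<^sub>R layer_component V k x i)"
  using layer_family_layer_component [of x] subspace_layer
  by (auto simp: layer_family_def intro: subspace_scale)

lemma layer_component_scaleR:
  "layer_component V k (r *\<^sub>R x) i = r *\<^sub>R layer_component V k x i"
  using layer_component_sum [OF layer_family_scale [of "\<lambda>_. r" x]]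
  by (simp add: sum_layer_component del: One_nat_def flip: scaleR_sum_right)

lemma linear_layer_component: "linear (\<lambda>x. layer_component V k x i)"
  by (intro linearI layer_component_add layer_component_scaleR)

lemma layer_component_dilation:
  "layer_component V k (dilation V k r x) i = r ^ i *\<^sub>R layer_component V k x i"
  unfolding dilation_def by (simp add: layer_component_sum [OF layer_family_scale] del: One_nat_def)

lemma dilation_dilation: "dilation V k r (dilation V k s x) = dilation V k (r * s) x"
  unfolding dilation_def [of V k r] dilation_def [of V k "r * s"] layer_component_dilation
  by (simp add: power_mult_distrib)

lemma dilation_1: "dilation V k 1 x = x"
  by (simp add: dilation_def sum_layer_component del: One_nat_def)

lemma dilation_0: "dilation V k 0 x = 0"
  by (simp add: dilation_def power_0_left)

lemma dilation_layer_1: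
  assumes "1 \<le> k" "x \<in> V 1"
  shows "dilation V k r x = r *\<^sub>R x"
proof -
  let ?c = "\<lambda>i. if i = 1 then x else 0"
  have "layer_family V k ?c"
    using assms subspace_layer by (auto simp: layer_family_def intro: subspace_0)
  from layer_component_sum [OF this] have "layer_component V k x = ?c"
    using assms by simp
  then show ?thesis
    using assms by (simp add: dilation_def if_distrib cong: if_cong)
qed

end

section \<open>Comparison of the homogeneous norm with the Euclidean norm\<close>

context
  fixes mul :: "'a::euclidean_space \<Rightarrow> 'a \<Rightarrow> 'a" and V :: "nat \<Rightarrow> 'a set" and k :: nat
    and N :: "'a \<Rightarrow> real"
  assumes decomp: "direct_sum_decomp V k" and hom: "homogeneous_norm mul V k N"
begin

lemma homogeneous_norm_dilation: "0 < r \<Longrightarrow> N (dilation V k r x) = r * N x"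
  and homogeneous_norm_nonneg: "0 \<le> N x"
  and homogeneous_norm_pos_iff: "0 < N x \<longleftrightarrow> x \<noteq> 0"
  and continuous_on_homogeneous_norm: "continuous_on UNIV N"
  using hom by (auto simp: homogeneous_norm_def)

text \<open>A point outside the ball of radius \<open>r\<close> is contracted by a dilation to the sphere of
  radius \<open>r\<close>, which does not increase \<open>N\<close>.\<close>

lemma homogeneous_norm_small_imp_norm_le:
  assumes "0 < r"
  obtains m where "0 < m" "\<And>x. N x \<le> m \<Longrightarrow> norm x \<le> r"
proof -
  have cont: "continuous_on (sphere 0 r) N"
    using continuous_on_homogeneous_norm continuous_on_subset by blast
  have "sphere (0::'a) r \<noteq> {}"
    using assms by simp
  then obtain x0 where x0: "x0 \<in> sphere 0 r" "\<And>x. x \<in> sphere 0 r \<Longrightarrow> N x0 \<le> N x"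
    using continuous_attains_inf [OF compact_sphere _ cont] by blast
  have pos: "0 < N x0"
    using x0(1) assms homogeneous_norm_pos_iff [of x0] by auto
  \<comment> \<open>Half of the minimum over the sphere, so that \<open>N x0 \<le> N x\<close> is a
    contradiction.\<close>
  have "norm x \<le> r" if "N x \<le> N x0 / 2" for x
  proof (rule ccontr)
    assume "\<not> norm x \<le> r"
    moreover have "continuous_on {0..1} (\<lambda>s. norm (dilation V k s x))"
      unfolding dilation_def by (intro continuous_intros)
    \<comment> \<open>The curve \<open>s \<mapsto> dilation V k s x\<close> runs from
      \<open>0\<close> to \<open>x\<close>, so its norm takes the value \<open>r\<close> on the
      way.\<close>
    ultimately have "\<exists>s. 0 \<le> s \<and> s \<le> 1 \<and> norm (dilation V k s x) = r"
      using assms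
      by (intro IVT') (simp_all add: dilation_0 [OF decomp] dilation_1 [OF decomp])
    then obtain s where s: "0 \<le> s" "s \<le> 1" "norm (dilation V k s x) = r"
      by blast
    then have "s > 0"
      using assms by (cases "s = 0") (auto simp: dilation_0 [OF decomp])
    have "N x0 \<le> N (dilation V k s x)"
      using s by (intro x0) simp
    also have "\<dots> = s * N x"
      by (rule homogeneous_norm_dilation) fact
    also have "\<dots> \<le> N x"
      using s homogeneous_norm_nonneg by (simp add: mult_left_le_one_le)
    finally show False
      using that pos by simp
  qed
  with pos show ?thesis
    by (intro that [of "N x0 / 2"]) auto
qed

text \<open>Dilating by \<open>1/t\<close> reduces the claim to the previous lemma at unit scale.
  Dilating back multiplies layer \<open>i\<close> by \<open>t ^ i\<close>, which is at most
  \<open>t\<close> because \<open>i \<ge> 1\<close> and \<open>t \<le> 1\<close>.\<close>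

lemma homogeneous_norm_le_imp_norm_le:
  assumes "0 < \<eta>"
  obtains m where "0 < m" "\<And>x t. \<lbrakk>0 < t; t \<le> 1; N x \<le> m * t\<rbrakk> \<Longrightarrow> norm x \<le> \<eta> * t"
proof -
  have "\<exists>B>0. \<forall>x. norm (layer_component V k x i) \<le> B * norm x" for i
    using linear_bounded_pos [OF linear_layer_component [OF decomp]] by metis
  then obtain B where B: "\<And>i. B i > 0" "\<And>i x. norm (layer_component V k x i) \<le> B i * norm x"
    by metis
  \<comment> \<open>Bounds the total cost of splitting a vector into layers; the summand 1 makes
    \<open>C\<close> positive, so that \<open>\<eta> / C\<close> is a legitimate radius.\<close>
  define C where "C = 1 + (\<Sum>i=1..k. B i)"
  have C: "C > 0" "(\<Sum>i=1..k. B i) \<le> C"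
    using sum_nonneg [of "{1..k}" B] B(1) by (simp_all add: C_def less_imp_le del: One_nat_def)
  obtain m where m: "0 < m" "\<And>x. N x \<le> m \<Longrightarrow> norm x \<le> \<eta> / C"
    using homogeneous_norm_small_imp_norm_le [of "\<eta> / C"] assms C by (metis divide_pos_pos)
  have "norm x \<le> \<eta> * t" if t: "0 < t" "t \<le> 1" "N x \<le> m * t" for x t
  proof -
    define y where "y = dilation V k (inverse t) x"
    have x: "x = dilation V k t y"
      using t by (simp add: y_def dilation_dilation [OF decomp] dilation_1 [OF decomp])
    have "t * N y \<le> t * m"
      using t homogeneous_norm_dilation [of t y] by (simp add: mult.commute flip: x)
    then have "N y \<le> m"
      using t by simp
    then have y: "norm y \<le> \<eta> / C"
      by (rule m)
    have "norm x \<le> (\<Sum>i=1..k. norm (t ^ i *\<^sub>R layer_component V k y i))"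
      unfolding x dilation_def by (rule norm_sum)
    also have "\<dots> \<le> (\<Sum>i=1..k. t * (B i * norm y))"
    proof (rule sum_mono)
      fix i assume "i \<in> {1..k}"
      then have "t ^ i \<le> t ^ 1"
        using t by (intro power_decreasing) auto
      then show "norm (t ^ i *\<^sub>R layer_component V k y i) \<le> t * (B i * norm y)"
        using t B(2) [where i = i and x = y] by (auto intro: mult_mono)
    qed
    also have "\<dots> = t * norm y * (\<Sum>i=1..k. B i)"
      by (simp add: sum_distrib_left mult_ac)
    also have "\<dots> \<le> t * norm y * C"
      using t C by (intro mult_left_mono) auto
    also have "\<dots> \<le> t * \<eta>"
      using t y C by (simp add: field_simps)
    finally show ?thesis
      by (simp add: mult.commute)
  qed
  with m(1) show ?thesis
    by (rule that)
qed

end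


section \<open>The group law near the identity and the shape of narrow cones\<close>

context carnot_group
begin

lemma Ck_on_1_mul: "Ck_on 1 (\<lambda>z. mul (fst z) (snd z)) UNIV"
  using smooth_mul by (simp add: smooth_on_def del: One_nat_def)

text \<open>As \<open>0\<close> is neutral, both partial maps \<open>h \<mapsto> h 0\<close> and
  \<open>l \<mapsto> 0 l\<close> are the identity; linearity adds their derivatives.\<close>

lemma mul_has_derivative_0:
  "((\<lambda>z. mul (fst z) (snd z)) has_derivative (\<lambda>z. fst z + snd z)) (at (0, 0))"
proof -
  let ?M = "\<lambda>z. mul (fst z) (snd z)"
  let ?L = "frechet_derivative ?M (at (0, 0))"
  have der: "(?M has_derivative ?L) (at (0, 0))"
    by (rule Ck_on_1_has_derivative [OF Ck_on_1_mul]) simp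
  interpret L: bounded_linear ?L
    by (rule has_derivative_bounded_linear [OF der])
  have "((\<lambda>h. ?M (h, 0)) has_derivative (\<lambda>h. ?L (h, 0))) (at 0)"
    by (rule has_derivative_compose [where f = "\<lambda>h. (h, 0)" and g = ?M])
       (auto intro!: derivative_eq_intros der)
  then have fst: "?L (h, 0) = h" for h
    using has_derivative_unique [OF _ has_derivative_ident [of "at (0::'a)"]]
    by (auto simp: fun_eq_iff)
  have "((\<lambda>l. ?M (0, l)) has_derivative (\<lambda>l. ?L (0, l))) (at 0)"
    by (rule has_derivative_compose [where f = "\<lambda>l. (0, l)" and g = ?M])
       (auto intro!: derivative_eq_intros der)
  then have snd: "?L (0, l) = l" for l
    using has_derivative_unique [OF _ has_derivative_ident [of "at (0::'a)"]]
    by (auto simp: fun_eq_iff)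
  have "?L z = fst z + snd z" for z
    using L.add [of "(fst z, 0)" "(0, snd z)"] by (simp add: fst snd)
  then have "?L = (\<lambda>z. fst z + snd z)" ..
  with der show ?thesis
    by simp
qed

text \<open>The \<epsilon>-\<delta> form of differentiability at the origin: to first order, group
  multiplication is vector addition.\<close>

lemma norm_mul_diff_le:
  assumes "0 < \<epsilon>"
  obtains \<delta> where "0 < \<delta>"
    "\<And>h l. norm h + norm l < \<delta> \<Longrightarrow> norm (mul h l - h - l) \<le> \<epsilon> * (norm h + norm l)"
proof -
  obtain \<delta> where \<delta>: "0 < \<delta>"
    "\<And>h l. norm (h, l) < \<delta> \<Longrightarrow> norm (mul h l - (h + l)) \<le> \<epsilon> * norm (h, l)"
    using mul_has_derivative_0 assms unfolding has_derivative_at_alt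
    by (force simp flip: zero_prod_def)
  have le: "norm (h, l) \<le> norm h + norm l" for h l :: 'a
    by (rule norm_Pair_le)
  show ?thesis
  proof (rule that [OF \<delta>(1)])
    fix h l :: 'a
    assume "norm h + norm l < \<delta>"
    then have "norm (mul h l - (h + l)) \<le> \<epsilon> * norm (h, l)"
      using le [of h l] by (intro \<delta>(2)) linarith
    also have "\<dots> \<le> \<epsilon> * (norm h + norm l)"
      using assms le by (intro mult_left_mono) auto
    finally show "norm (mul h l - h - l) \<le> \<epsilon> * (norm h + norm l)"
      by (simp add: diff_diff_add)
  qed
qed

text \<open>Since \<open>N h \<le> \<beta> N (t X)\<close> forces \<open>norm h = o(t)\<close> as \<open>\<beta> \<rightarrow> 0\<close>, the cone is Euclidean close to
  the ray in direction \<open>X\<close>.\<close>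

lemma intrinsic_cone_direction:
  assumes hom: "homogeneous_norm mul V k N" and X: "X \<in> V 1" "X \<noteq> 0" and "0 < \<epsilon>"
  obtains \<beta> \<rho> where "0 < \<beta>" "0 < \<rho>"
    "\<And>p q. q \<in> intrinsic_cone mul V k ip N p \<beta> \<rho> X - {p} \<Longrightarrow>
       \<exists>t v. 0 < t \<and> t < \<epsilon> \<and> norm (v - X) < \<epsilon> \<and> q = mul p (t *\<^sub>R v)"
proof -
  note norm = decomp hom
  have NX: "0 < N X"
    using X homogeneous_norm_pos_iff [OF norm] by blast
  \<comment> \<open>The allowed error \<open>\<epsilon> t\<close> is shared out:
    \<open>\<eta>\<close> spends a quarter on \<open>norm h\<close>, and \<open>\<mu>\<close> below
    a quarter on the deviation of the product from the sum, its factor \<open>1 + norm X\<close>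
    coming from \<open>norm h + norm (t X) \<le> t (1 + norm X)\<close>. The bound
    \<open>\<eta> \<le> 1\<close> is what gives \<open>norm h \<le> t\<close>.\<close>
  define \<eta> where "\<eta> = min (\<epsilon> / 4) 1"
  have \<eta>: "0 < \<eta>" "\<eta> \<le> \<epsilon> / 4" "\<eta> \<le> 1"
    using \<open>0 < \<epsilon>\<close> by (auto simp: \<eta>_def)
  define \<mu> where "\<mu> = \<epsilon> / (4 * (1 + norm X))"
  have "0 < 1 + norm X"
    by (simp add: add_pos_nonneg)
  then have \<mu>: "0 < \<mu>" "\<mu> * (1 + norm X) = \<epsilon> / 4"
    using \<open>0 < \<epsilon>\<close> by (auto simp: \<mu>_def field_simps)
  obtain m where m: "0 < m" "\<And>x t. \<lbrakk>0 < t; t \<le> 1; N x \<le> m * t\<rbrakk> \<Longrightarrow> norm x \<le> \<eta> * t"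
    using homogeneous_norm_le_imp_norm_le [OF norm \<eta>(1)] by metis
  obtain \<delta> where \<delta>: "0 < \<delta>"
    "\<And>h l. norm h + norm l < \<delta> \<Longrightarrow> norm (mul h l - h - l) \<le> \<mu> * (norm h + norm l)"
    using norm_mul_diff_le [OF \<mu>(1)] by metis
  \<comment> \<open>The bound on \<open>t\<close>: below 1 for the choice of \<open>m\<close>, below
    \<open>\<epsilon>\<close> for the conclusion, and small enough that
    \<open>t (1 + norm X) < \<delta>\<close>.\<close>
  define \<tau> where "\<tau> = min (min 1 \<epsilon>) (\<delta> / (1 + norm X))"
  have \<tau>: "0 < \<tau>" "\<tau> \<le> 1" "\<tau> \<le> \<epsilon>" "\<tau> \<le> \<delta> / (1 + norm X)"
    using \<open>0 < \<epsilon>\<close> \<delta> \<open>0 < 1 + norm X\<close> by (auto simp: \<tau>_def)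
  show ?thesis
  proof (rule that)
    \<comment> \<open>Because \<open>N (t X) = t N X\<close>, these constants turn the two cone
      conditions into \<open>N h \<le> m t\<close> and \<open>t < \<tau>\<close>.\<close>
    show "0 < m / N X" "0 < \<tau> * N X"
      using m \<tau> NX by auto
    fix p q
    assume "q \<in> intrinsic_cone mul V k ip N p (m / N X) (\<tau> * N X) X - {p}"
    then obtain h t where q: "q = mul p (mul h (t *\<^sub>R X))" "q \<noteq> p" and "0 \<le> t"
      and h: "N h \<le> m / N X * N (t *\<^sub>R X)" and t: "N (t *\<^sub>R X) < \<tau> * N X"
      by (auto simp: intrinsic_cone_def K_ray_def exp_coordinates)
    \<comment> \<open>For \<open>t = 0\<close> the cone condition forces \<open>h = 0\<close>, which
      leaves only the removed vertex \<open>p\<close>.\<close>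
    have "t \<noteq> 0"
    proof
      assume "t = 0"
      then have "N h \<le> 0"
        using h homogeneous_norm_pos_iff [OF norm, of 0] homogeneous_norm_nonneg [OF norm, of 0]
        by simp
      then have "h = 0"
        using homogeneous_norm_pos_iff [OF norm, of h] by auto
      then show False
        using q \<open>t = 0\<close> by simp
    qed
    with \<open>0 \<le> t\<close> have "0 < t"
      by simp
    then have NtX: "N (t *\<^sub>R X) = t * N X"
      using homogeneous_norm_dilation [OF norm, of t X] dilation_layer_1 [OF decomp step_pos X(1)]
      by simp
    then have "t < \<tau>"
      using t NX by simp
    have nh: "norm h \<le> \<eta> * t"
      using m(2) [of t h] \<open>0 < t\<close> \<open>t < \<tau>\<close> \<tau> h NX by (simp add: NtX)
    also have "\<dots> \<le> t"
      using \<eta> \<open>0 < t\<close> by simp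
    finally have sum: "norm h + norm (t *\<^sub>R X) \<le> t * (1 + norm X)"
      using \<open>0 < t\<close> by (simp add: algebra_simps)
    also have "\<dots> < \<delta>"
      using order.strict_trans2 [OF \<open>t < \<tau>\<close> \<tau>(4)] pos_less_divide_eq [OF \<open>0 < 1 + norm X\<close>]
      by blast
    finally have "norm (mul h (t *\<^sub>R X) - h - t *\<^sub>R X) \<le> \<mu> * (norm h + norm (t *\<^sub>R X))"
      by (rule \<delta>(2))
    also have "\<dots> \<le> \<mu> * (t * (1 + norm X))"
      using sum \<mu>(1) by (intro mult_left_mono) auto
    also have "\<dots> = t * (\<epsilon> / 4)"
      using \<mu>(2) by (simp add: mult_ac)
    finally have "norm (mul h (t *\<^sub>R X) - t *\<^sub>R X) \<le> norm h + t * (\<epsilon> / 4)"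
      using norm_triangle_ineq [of h "mul h (t *\<^sub>R X) - h - t *\<^sub>R X"] by simp
    also have "\<dots> \<le> t * (\<epsilon> / 2)"
      using order_trans [OF nh mult_right_mono [OF \<eta>(2) less_imp_le [OF \<open>0 < t\<close>]]]
      by (simp add: mult.commute)
    also have "\<dots> < t * \<epsilon>"
      using \<open>0 < t\<close> \<open>0 < \<epsilon>\<close> by simp
    finally have close: "norm (mul h (t *\<^sub>R X) - t *\<^sub>R X) < t * \<epsilon>" .
    define v where "v = mul h (t *\<^sub>R X) /\<^sub>R t"
    have v: "mul h (t *\<^sub>R X) = t *\<^sub>R v"
      using \<open>0 < t\<close> by (simp add: v_def)
    have "norm (v - X) < \<epsilon>"
      using close \<open>0 < t\<close> unfolding v by (simp flip: scaleR_diff_right)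
    then show "\<exists>t v. 0 < t \<and> t < \<epsilon> \<and> norm (v - X) < \<epsilon> \<and> q = mul p (t *\<^sub>R v)"
      using \<open>0 < t\<close> \<open>t < \<tau>\<close> \<tau>(3) q(1) v by (intro exI [of _ t] exI [of _ v]) auto
  qed
qed

section \<open>Outward horizontal directions and cones near one boundary point\<close>

text \<open>Chain rule along \<open>y \<mapsto> (p, y)\<close>. Expressing the field through the
  derivative of the full multiplication map gives access to joint continuity in \<open>p\<close> and
  \<open>v\<close>.\<close>

lemma left_field_linear: "linear (\<lambda>v. left_field mul v p)"
  and left_field_eq:
    "left_field mul v p = frechet_derivative (\<lambda>z. mul (fst z) (snd z)) (at (p, 0)) (0, v)"
proof -
  let ?M = "\<lambda>z. mul (fst z) (snd z)"
  have der: "(?M has_derivative frechet_derivative ?M (at (p, 0))) (at (p, 0))"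
    by (rule Ck_on_1_has_derivative [OF Ck_on_1_mul]) simp
  have *: "((\<lambda>y. ?M (p, y)) has_derivative (\<lambda>v. frechet_derivative ?M (at (p, 0)) (0, v))) (at 0)"
    by (rule has_derivative_compose [where f = "\<lambda>y. (p, y)" and g = ?M])
       (auto intro!: derivative_eq_intros der)
  then have "frechet_derivative (mul p) (at 0) = (\<lambda>v. frechet_derivative ?M (at (p, 0)) (0, v))"
    by (simp flip: frechet_derivative_at [of "mul p"])
  then show "left_field mul v p = frechet_derivative ?M (at (p, 0)) (0, v)" for v
    by (simp add: left_field_def)
  then show "linear (\<lambda>v. left_field mul v p)"
    using has_derivative_linear [OF *] by simp
qed

text \<open>Some left-translated horizontal \<open>w\<close> is not tangent, so by
  \<open>kernel_subset_tangent_vectors\<close> it is not annihilated by \<open>D\<Phi>\<close>.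
  Rescaling gives unit length and the right sign.\<close>

lemma exists_outward_horizontal:
  fixes \<Phi> :: "'a \<Rightarrow> real"
  assumes ip: "inner_product_on (V 1) ip"
    and "open U" "p \<in> U" and C1: "Ck_on 1 \<Phi> U"
    and level: "frontier \<Omega> \<inter> U = {x\<in>U. \<Phi> x = 0}" and "p \<in> frontier \<Omega>"
    and nz: "frechet_derivative \<Phi> (at p) \<noteq> (\<lambda>_. 0)"
    and nchar: "\<not> characteristic_point mul V \<Omega> p"
  obtains X where "X \<in> V 1" "ip X X = 1" "frechet_derivative \<Phi> (at p) (left_field mul X p) > 0"
proof -
  obtain w where w: "w \<in> V 1" "left_field mul w p \<notin> tangent_vectors (frontier \<Omega>) p"
    using nchar \<open>p \<in> frontier \<Omega>\<close> by (auto simp: characteristic_point_def horizontal_space_def)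
  let ?F = "\<lambda>v. frechet_derivative \<Phi> (at p) (left_field mul v p)"
  have "?F w \<noteq> 0"
    using kernel_subset_tangent_vectors [OF \<open>open U\<close> \<open>p \<in> U\<close> C1 level \<open>p \<in> frontier \<Omega>\<close> nz] w
    by blast
  interpret F: linear ?F
    using linear_compose [OF left_field_linear
        has_derivative_linear [OF Ck_on_1_has_derivative [OF C1 \<open>p \<in> U\<close>]]]
    by (simp add: o_def)
  have V1: "subspace (V 1)"
    using subspace_layer [OF decomp] step_pos by auto
  have "w \<noteq> 0"
    using \<open>?F w \<noteq> 0\<close> F.zero by auto
  then have "0 < ip w w"
    using ip w by (auto simp: inner_product_on_def)
  \<comment> \<open>\<open>inner_product_on\<close> states homogeneity in the first argument only,
    so the second factor \<open>r\<close> is extracted by symmetry.\<close>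
  have scale: "ip (r *\<^sub>R w) (r *\<^sub>R w) = r * r * ip w w" for r
  proof -
    have rw: "r *\<^sub>R w \<in> V 1"
      by (rule subspace_scale [OF V1 w(1)])
    have "ip (r *\<^sub>R w) (r *\<^sub>R w) = r * ip w (r *\<^sub>R w)"
      using ip w(1) rw unfolding inner_product_on_def by blast
    also have "ip w (r *\<^sub>R w) = ip (r *\<^sub>R w) w"
      using ip w(1) rw unfolding inner_product_on_def by blast
    also have "\<dots> = r * ip w w"
      using ip w(1) unfolding inner_product_on_def by blast
    finally show ?thesis
      by simp
  qed
  define r where "r = sgn (?F w) / sqrt (ip w w)"
  have "r * r * ip w w = 1"
    using \<open>0 < ip w w\<close> \<open>?F w \<noteq> 0\<close> by (auto simp: r_def sgn_if)
  moreover have "0 < ?F (r *\<^sub>R w)"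
    using \<open>0 < ip w w\<close> \<open>?F w \<noteq> 0\<close> by (auto simp: r_def sgn_if F.scale zero_less_mult_iff)
  ultimately show ?thesis
    using that [of "r *\<^sub>R w"] subspace_scale [OF V1 w(1)] scale by auto
qed

text \<open>The constants and the axis are fixed before \<open>p\<close>, which is what the
  compactness argument consumes. Along \<open>s \<mapsto> p (s v)\<close> the function
  \<open>\<Phi>\<close> starts at 0 and has positive derivative.\<close>

lemma local_exterior_cone:
  assumes ip: "inner_product_on (V 1) ip" and hom: "homogeneous_norm mul V k N"
    and C1b: "C1_boundary \<Omega>" and p0: "p0 \<in> frontier \<Omega>"
    and nchar: "\<not> characteristic_point mul V \<Omega> p0"
  obtains W X \<beta> \<rho> where "open W" "p0 \<in> W" "X \<in> V 1" "ip X X = 1" "0 < \<beta>" "0 < \<rho>"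
    "\<And>p. p \<in> W \<inter> frontier \<Omega> \<Longrightarrow> intrinsic_cone mul V k ip N p \<beta> \<rho> X - {p} \<subseteq> UNIV - closure \<Omega>"
proof -
  from bspec [OF C1b [unfolded C1_boundary_def] p0]
  obtain U and \<Phi> :: "'a \<Rightarrow> real" where U: "open U" "p0 \<in> U" and C1: "Ck_on 1 \<Phi> U"
    and nz: "\<forall>x\<in>U. frechet_derivative \<Phi> (at x) \<noteq> (\<lambda>_. 0)"
    and zero: "frontier \<Omega> \<inter> U = {x\<in>U. \<Phi> x = 0}"
    and pos: "U - closure \<Omega> = {x\<in>U. \<Phi> x > 0}"
    by (elim exE conjE) (rule that, assumption+)
  obtain X where X: "X \<in> V 1" "ip X X = 1" "frechet_derivative \<Phi> (at p0) (left_field mul X p0) > 0"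
    using exists_outward_horizontal [OF ip U C1 zero p0 bspec [OF nz U(2)] nchar] by blast
  have "X \<noteq> 0"
  proof
    assume "X = 0"
    have "ip (0 *\<^sub>R X) X = 0 * ip X X"
      using ip X(1) unfolding inner_product_on_def by blast
    then show False
      using X(2) \<open>X = 0\<close> by simp
  qed
  let ?M = "\<lambda>z. mul (fst z) (snd z)"
  \<comment> \<open>\<open>E (p, y, v)\<close> is the derivative of
    \<open>y \<mapsto> \<Phi> (p y)\<close> at \<open>y\<close> in direction \<open>v\<close>;
    \<open>B\<close> is the open set where \<open>p y\<close> stays in \<open>U\<close>.\<close>
  define E where "E z = (case z of (p, y, v) \<Rightarrow>
      frechet_derivative \<Phi> (at (mul p y)) (frechet_derivative ?M (at (p, y)) (0, v)))" for z
  define B :: "('a \<times> 'a \<times> 'a) set" where "B = {z. mul (fst z) (fst (snd z)) \<in> U}"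
  have derM: "(?M has_derivative frechet_derivative ?M (at z)) (at z)" for z
    by (rule Ck_on_1_has_derivative [OF Ck_on_1_mul]) simp
  have contM: "continuous_on UNIV ?M"
    by (intro continuous_at_imp_continuous_on ballI has_derivative_continuous [OF derM])
  have contM': "continuous_on S (\<lambda>z. mul (f z) (g z))"
    if "continuous_on S f" "continuous_on S g" for S and f g :: "'a \<times> 'a \<times> 'a \<Rightarrow> 'a"
    using continuous_on_compose2 [OF contM continuous_on_Pair [OF that]] by simp
  have "open ((\<lambda>z :: 'a \<times> 'a \<times> 'a. mul (fst z) (fst (snd z))) -` U)"
    by (intro open_vimage U(1) contM' continuous_intros)
  then have "open B"
    by (simp add: B_def vimage_def)
  have "continuous_on B (\<lambda>z. frechet_derivative ?M (at (fst z, fst (snd z))) (0, snd (snd z)))"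
    using continuous_on_compose2 [OF Ck_on_1_continuous_on_derivative [OF Ck_on_1_mul],
        of B "\<lambda>z. ((fst z, fst (snd z)), (0, snd (snd z)))"]
    by (simp add: continuous_intros)
  then have "continuous_on B (\<lambda>z. (mul (fst z) (fst (snd z)),
      frechet_derivative ?M (at (fst z, fst (snd z))) (0, snd (snd z))))"
    by (intro continuous_on_Pair contM' continuous_intros)
  from continuous_on_compose2 [OF Ck_on_1_continuous_on_derivative [OF C1] this]
  have contE: "continuous_on B E"
    by (simp add: E_def [abs_def] case_prod_beta B_def image_subset_iff)
  have "(p0, 0, X) \<in> B" "E (p0, 0, X) > 0"
    using U(2) X(3) by (simp_all add: B_def E_def left_field_eq)
  moreover have "open {z\<in>B. E z > 0}"
  proof -
    have "{z\<in>B. E z > 0} = B \<inter> E -` {0<..}"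
      by auto
    then show ?thesis
      using continuous_open_preimage [OF contE \<open>open B\<close> open_greaterThan [of 0]] by (simp only:)
  qed
  ultimately obtain r where r: "0 < r" "ball (p0, 0, X) r \<subseteq> {z\<in>B. E z > 0}"
    using open_contains_ball [of "{z\<in>B. E z > 0}"] by blast
  \<comment> \<open>The three distances in \<open>near\<close> add up to less than
    \<open>\<epsilon> (3 + norm X)\<close>, hence stay below \<open>r\<close>. The cap 1 yields
    \<open>norm v < 1 + norm X\<close> for \<open>v\<close> within \<open>\<epsilon>\<close> of
    \<open>X\<close>.\<close>
  define \<epsilon> where "\<epsilon> = min 1 (r / (4 + norm X))"
  have 4: "0 < 4 + norm X"
    by (simp add: add_pos_nonneg)
  then have \<epsilon>: "0 < \<epsilon>" "\<epsilon> \<le> 1"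
    using r(1) by (auto simp: \<epsilon>_def)
  have "\<epsilon> \<le> r / (4 + norm X)"
    by (simp add: \<epsilon>_def)
  then have \<epsilon>r: "\<epsilon> * (4 + norm X) \<le> r"
    using pos_le_divide_eq [OF 4] by blast
  have near: "mul p y \<in> U" "E (p, y, v) > 0"
    if "dist p0 p < \<epsilon>" "norm y < \<epsilon> * (1 + norm X)" "norm (v - X) < \<epsilon>" for p y v
  proof -
    have "dist (p0, 0, X) (p, y, v) \<le> dist p0 p + (norm y + norm (v - X))"
      using norm_Pair_le [of "p0 - p" "(- y, X - v)"] norm_Pair_le [of "- y" "X - v"]
      by (simp add: dist_norm norm_minus_commute)
    also have "\<dots> < \<epsilon> * (4 + norm X)"
      using that \<epsilon> by (simp add: algebra_simps)
    finally have "(p, y, v) \<in> ball (p0, 0, X) r"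
      using \<epsilon>r by simp
    then show "mul p y \<in> U" "E (p, y, v) > 0"
      using r(2) by (auto simp: B_def)
  qed
  obtain \<beta> \<rho> where \<beta>\<rho>: "0 < \<beta>" "0 < \<rho>"
    "\<And>p q. q \<in> intrinsic_cone mul V k ip N p \<beta> \<rho> X - {p} \<Longrightarrow>
       \<exists>t v. 0 < t \<and> t < \<epsilon> \<and> norm (v - X) < \<epsilon> \<and> q = mul p (t *\<^sub>R v)"
    using intrinsic_cone_direction [OF hom X(1) \<open>X \<noteq> 0\<close> \<epsilon>(1)] by metis
  show ?thesis
  proof (rule that)
    show "open (ball p0 \<epsilon>)" "p0 \<in> ball p0 \<epsilon>" "X \<in> V 1" "ip X X = 1" "0 < \<beta>" "0 < \<rho>"
      using \<epsilon> X \<beta>\<rho> by auto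
    fix p assume p: "p \<in> ball p0 \<epsilon> \<inter> frontier \<Omega>"
    show "intrinsic_cone mul V k ip N p \<beta> \<rho> X - {p} \<subseteq> UNIV - closure \<Omega>"
    proof
      fix q assume "q \<in> intrinsic_cone mul V k ip N p \<beta> \<rho> X - {p}"
      then obtain t v where t: "0 < t" "t < \<epsilon>" and v: "norm (v - X) < \<epsilon>" and q: "q = mul p (t *\<^sub>R v)"
        using \<beta>\<rho>(3) by blast
      have "norm v < 1 + norm X"
        using v \<epsilon>(2) norm_triangle_ineq [of "v - X" X] by simp
      then have small: "norm (s *\<^sub>R v) < \<epsilon> * (1 + norm X)" if "0 \<le> s" "s \<le> t" for s
        using that t \<epsilon> by (simp add: mult_strict_mono')
      have U': "mul p (s *\<^sub>R v) \<in> U" and E: "E (p, s *\<^sub>R v, v) > 0" if "0 \<le> s" "s \<le> t" for s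
        using near [OF _ small [OF that] v] p by auto
      have "((\<lambda>s. \<Phi> (?M (p, s *\<^sub>R v))) has_real_derivative E (p, s *\<^sub>R v, v)) (at s)"
        if "0 \<le> s" "s \<le> t" for s
      proof -
        have "((\<lambda>s. ?M (p, s *\<^sub>R v)) has_derivative
            (\<lambda>c. frechet_derivative ?M (at (p, s *\<^sub>R v)) (0, c *\<^sub>R v))) (at s)"
          by (rule has_derivative_compose [where f = "\<lambda>s. (p, s *\<^sub>R v)" and g = ?M])
             (auto intro!: derivative_eq_intros derM)
        moreover have der\<Phi>: "(\<Phi> has_derivative frechet_derivative \<Phi> (at (mul p (s *\<^sub>R v))))
            (at (mul p (s *\<^sub>R v)))"
          using Ck_on_1_has_derivative [OF C1 U' [OF that]] .
        ultimately have *: "((\<lambda>s. \<Phi> (?M (p, s *\<^sub>R v))) has_derivative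
            (\<lambda>c. frechet_derivative \<Phi> (at (mul p (s *\<^sub>R v)))
              (frechet_derivative ?M (at (p, s *\<^sub>R v)) (0, c *\<^sub>R v)))) (at s)"
          using has_derivative_compose [where g = \<Phi> and f = "\<lambda>s. ?M (p, s *\<^sub>R v)"] by simp
        interpret D\<Phi>: linear "frechet_derivative \<Phi> (at (mul p (s *\<^sub>R v)))"
          using der\<Phi> by (rule has_derivative_linear)
        interpret DM: linear "frechet_derivative ?M (at (p, s *\<^sub>R v))"
          using derM by (rule has_derivative_linear)
        have "frechet_derivative \<Phi> (at (mul p (s *\<^sub>R v)))
            (frechet_derivative ?M (at (p, s *\<^sub>R v)) (0, c *\<^sub>R v)) = E (p, s *\<^sub>R v, v) * c" for c
          using DM.scale [of c "(0, v)"] D\<Phi>.scale [of c] by (simp add: E_def mult.commute)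
        with * show ?thesis
          unfolding has_field_derivative_def by (simp only:)
      qed
      \<comment> \<open>Mean value theorem on \<open>[0, t]\<close>: with
        \<open>\<Phi> p = 0\<close> it gives \<open>\<Phi> q = t E (p, s v, v) > 0\<close>.\<close>
      then obtain s where "0 < s" "s < t"
        "\<Phi> (?M (p, t *\<^sub>R v)) - \<Phi> (?M (p, 0 *\<^sub>R v)) = (t - 0) * E (p, s *\<^sub>R v, v)"
        using MVT2 [OF t(1), of "\<lambda>s. \<Phi> (?M (p, s *\<^sub>R v))" "\<lambda>s. E (p, s *\<^sub>R v, v)"] by blast
      moreover have "\<Phi> p = 0"
        using zero p U' [of 0] t by auto
      ultimately have "\<Phi> q > 0"
        using t E [of s] by (simp add: q)
      moreover have "q \<in> U"
        using U' [of t] t q by simp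
      ultimately show "q \<in> UNIV - closure \<Omega>"
        using pos by auto
    qed
  qed
qed

end

section \<open>Uniform constants by compactness\<close>

lemma intrinsic_cone_mono:
  assumes "\<And>x. 0 \<le> N x" "\<beta> \<le> \<beta>'" "\<rho> \<le> \<rho>'"
  shows "intrinsic_cone mul V k ip N p \<beta> \<rho> X \<subseteq> intrinsic_cone mul V k ip N p \<beta>' \<rho>' X"
proof -
  have "\<beta> * N l \<le> \<beta>' * N l" for l
    using assms by (intro mult_right_mono) auto
  then show ?thesis
    unfolding intrinsic_cone_def using assms(3) by (intro image_mono) (force intro: order_trans)
qed

theorem theorem5p11:
  fixes mul :: "'a::euclidean_space \<Rightarrow> 'a \<Rightarrow> 'a"
    and V :: "nat \<Rightarrow> 'a set" and k :: nat
    and ip :: "'a \<Rightarrow> 'a \<Rightarrow> real" and N :: "'a \<Rightarrow> real"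
    and \<Omega> :: "'a set"
  assumes "carnot_group mul V k"
    and "inner_product_on (V 1) ip"
    and "homogeneous_norm mul V k N"
    and "open \<Omega>" and "connected \<Omega>" and "\<Omega> \<noteq> {}" and "bounded \<Omega>"
    and "compact (frontier \<Omega>)" and "C1_boundary \<Omega>"
    and "\<forall>p\<in>frontier \<Omega>. \<not> characteristic_point mul V \<Omega> p"
  shows "intrinsic_exterior_cone_condition mul V k ip N \<Omega>"
proof -
  interpret carnot_group mul V k by fact
  let ?P = "\<lambda>p \<beta> \<rho> X. X \<in> V 1 \<and> ip X X = 1 \<and>
    intrinsic_cone mul V k ip N p \<beta> \<rho> X - {p} \<subseteq> UNIV - closure \<Omega>"
  have "\<exists>W \<beta> \<rho>. open W \<and> p0 \<in> W \<and> 0 < \<beta> \<and> 0 < \<rho> \<and> (\<forall>p\<in>W \<inter> frontier \<Omega>. \<exists>X. ?P p \<beta> \<rho> X)"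
    if p0: "p0 \<in> frontier \<Omega>" for p0
  proof -
    obtain W X \<beta> \<rho> where "open W" "p0 \<in> W" "X \<in> V 1" "ip X X = 1" "0 < \<beta>" "0 < \<rho>"
      "\<And>p. p \<in> W \<inter> frontier \<Omega> \<Longrightarrow> intrinsic_cone mul V k ip N p \<beta> \<rho> X - {p} \<subseteq> UNIV - closure \<Omega>"
      using local_exterior_cone [OF assms(2,3,9) p0 bspec [OF assms(10) p0]] by blast
    then show ?thesis
      by blast
  qed
  then obtain W \<beta> \<rho> where W: "\<And>p0. p0 \<in> frontier \<Omega> \<Longrightarrow> open (W p0) \<and> p0 \<in> W p0"
    and pos: "\<And>p0. p0 \<in> frontier \<Omega> \<Longrightarrow> 0 < \<beta> p0 \<and> (0::real) < \<rho> p0"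
    and cone: "\<And>p0. p0 \<in> frontier \<Omega> \<Longrightarrow> \<forall>p\<in>W p0 \<inter> frontier \<Omega>. \<exists>X. ?P p (\<beta> p0) (\<rho> p0) X"
    by metis
  obtain F where F: "F \<subseteq> frontier \<Omega>" "finite F" "frontier \<Omega> \<subseteq> (\<Union>p\<in>F. W p)"
    using compactE_image [OF assms(8), of "frontier \<Omega>" W] W by blast
  \<comment> \<open>Smaller parameters give smaller cones, so the minimum over the finite subcover
    serves every boundary point; \<open>insert 1\<close> ensures that \<open>Min\<close> is taken
    over a nonempty set.\<close>
  define b where "b = Min (insert 1 (\<beta> ` F))"
  define r where "r = Min (insert 1 (\<rho> ` F))"
  have "0 < b" "0 < r"
    using F pos by (auto simp: b_def r_def)
  moreover have "\<exists>X\<in>V 1. ip X X = 1 \<and> intrinsic_cone mul V k ip N p b r X - {p} \<subseteq> UNIV - closure \<Omega>"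
    if p: "p \<in> frontier \<Omega>" for p
  proof -
    obtain p0 where p0: "p0 \<in> F" "p \<in> W p0"
      using F p by blast
    then obtain X where X: "?P p (\<beta> p0) (\<rho> p0) X"
      using cone F p by blast
    have "b \<le> \<beta> p0" "r \<le> \<rho> p0"
      using F p0 by (auto simp: b_def r_def)
    from intrinsic_cone_mono [where N = N, OF homogeneous_norm_nonneg [OF decomp assms(3)] this] X
    show ?thesis
      by blast
  qed
  ultimately show ?thesis
    unfolding intrinsic_exterior_cone_condition_def by blast
qed

end
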